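(* Let $X \in \{\mathit{eq},\mathit{disj},\mathit{closed}\}$ and let $F \subseteq \{\mathit{eq},\mathit{disj},\mathit{closed}\}$ be a feature set with $X \notin F$. Then the class of graphs $Q_X$ is not definable in $\mathcal{L}(F)$, i.e., there is no shape schema $\mathcal{S}\in\mathcal{L}(F)$ such that the graphs conforming to $\mathcal{S}$ are exactly the graphs in $Q_X$.
   Context: Fix two disjoint infinite sets $N$ (node names, also called constants) and $P$ (property names). Path expressions are given by $E ::= \mathit{id} \mid p \mid p^- \mid E\cup E \mid E\circ E \mid E^*$ with $p\in P$. Shapes are given by $\phi ::= \top \mid \{c\} \mid \phi\land\phi \mid \phi\lor\phi \mid \neg\phi \mid {\geq_n E}.\phi \mid \mathit{eq}(E,p) \mid \mathit{disj}(E,p) \mid \mathit{closed}(R)$, where $c\in N$, $n\geq 1$ is an integer, $p\in P$, and $R$ is a finite subset of $P$. A graph $G$ is a finite set of triples $(a,p,b)$ with $a,b\in N$, $p\in P$. Semantics on $G$ (domain $N$): $[\![p]\!]^G=\{(a,b):(a,p,b)\in G\}$, $[\![\mathit{id}]\!]^G$ is the identity relation on $N$, $p^-$ is the inverse, $\cup$ is union, $\circ$ is relational composition, $E^*$ is the reflexive-transitive closure on $N$. For a binary relation $R$, $R(x)=\{y:(x,y)\in R\}$. Then $G,a\models\top$ always; $G,a\models\{c\}$ iff $a=c$; boolean connectives as usual; $G,a\models {\geq_n E}.\psi$ iff at least $n$ elements $b\in[\![E]\!]^G(a)$ satisfy $G,b\models\psi$; $G,a\models\mathit{eq}(E,p)$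 iff $[\![E]\!]^G(a)=[\![p]\!]^G(a)$; $G,a\models\mathit{disj}(E,p)$ iff these sets are disjoint; $G,a\models\mathit{closed}(R)$ iff $[\![p]\!]^G(a)=\emptyset$ for every $p\in P\setminus R$. Write $[\![\phi]\!]^G=\{a\in N: G,a\models\phi\}$. A shape schema is a finite set of inclusions $\phi_1\subseteq\phi_2$ of shapes; $G$ conforms to it if $[\![\phi_1]\!]^G\subseteq[\![\phi_2]\!]^G$ for every inclusion. For a feature set $F\subseteq\{\mathit{eq},\mathit{disj},\mathit{closed}\}$, $\mathcal{L}(F)$ is the set of shape schemas in which the constructs $\mathit{eq}(E,p)$, $\mathit{disj}(E,p)$, $\mathit{closed}(R)$ are used only if $\mathit{eq}\in F$, $\mathit{disj}\in F$, $\mathit{closed}\in F$, respectively (all other constructs are always allowed). Fix a property name $r$. $Q_{\mathit{eq}}$ is the class of graphs $G$ such that $(a,r,b)\in G$ implies $(b,r,a)\in G$. $Q_{\mathit{disj}}$ is the class of graphs $G$ such that every node $a$ with some outgoing $r$-edge has some $b$ with $(a,r,b)\in G$ and $(b,r,a)\in G$. $Q_{\mathit{closed}}$ is the class of graphs $G$ such that for every node $a$ with an outgoing $r$-edge, every triple $(a,p,b)\in G$ has $p=r$. *)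

theory Defs
  imports Main "HOL-Library.FSet"
begin

text \<open>
  Node names (constants) are the elements of a type \<open>'n\<close>, property names the elements of a
  type \<open>'p\<close>, so the two sets of names are disjoint by typing. That both are infinite has to be
  assumed where it is needed.
\<close>

datatype 'p path =
    Ident
  | Prop 'p
  | Inv 'p
  | Union "'p path" "'p path"
  | Comp "'p path" "'p path"
  | Star "'p path"

datatype ('n, 'p) shape =
    Top
  | Const 'n
  | And "('n, 'p) shape" "('n, 'p) shape"
  | Or "('n, 'p) shape" "('n, 'p) shape"
  | Not "('n, 'p) shape"
  | AtLeast nat "'p path" "('n, 'p) shape"
  | Eq "'p path" 'p
  | Disj "'p path" 'p
  | Closed "'p fset"

text \<open>The datatype admits \<open>AtLeast 0\<close>; the grammar of shapes requires the bound to be positive.\<close>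

primrec wf_shape :: "('n, 'p) shape \<Rightarrow> bool" where
  "wf_shape Top \<longleftrightarrow> True"
| "wf_shape (Const c) \<longleftrightarrow> True"
| "wf_shape (And \<phi> \<psi>) \<longleftrightarrow> wf_shape \<phi> \<and> wf_shape \<psi>"
| "wf_shape (Or \<phi> \<psi>) \<longleftrightarrow> wf_shape \<phi> \<and> wf_shape \<psi>"
| "wf_shape (Not \<phi>) \<longleftrightarrow> wf_shape \<phi>"
| "wf_shape (AtLeast n E \<phi>) \<longleftrightarrow> 1 \<le> n \<and> wf_shape \<phi>"
| "wf_shape (Eq E p) \<longleftrightarrow> True"
| "wf_shape (Disj E p) \<longleftrightarrow> True"
| "wf_shape (Closed R) \<longleftrightarrow> True"

text \<open>Graphs are the finite sets of this type; finiteness is stated wherever graphs are quantified.\<close>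

type_synonym ('n, 'p) triples = "('n \<times> 'p \<times> 'n) set"

primrec path_sem :: "('n, 'p) triples \<Rightarrow> 'p path \<Rightarrow> ('n \<times> 'n) set" where
  "path_sem G Ident = Id"
| "path_sem G (Prop p) = {(a, b). (a, p, b) \<in> G}"
| "path_sem G (Inv p) = {(a, b). (a, p, b) \<in> G}\<inverse>"
| "path_sem G (Union E1 E2) = path_sem G E1 \<union> path_sem G E2"
| "path_sem G (Comp E1 E2) = path_sem G E1 O path_sem G E2"
| "path_sem G (Star E) = (path_sem G E)\<^sup>*"

primrec sat :: "('n, 'p) triples \<Rightarrow> 'n \<Rightarrow> ('n, 'p) shape \<Rightarrow> bool" where
  "sat G a Top \<longleftrightarrow> True"
| "sat G a (Const c) \<longleftrightarrow> a = c"
| "sat G a (And \<phi> \<psi>) \<longleftrightarrow> sat G a \<phi> \<and> sat G a \<psi>"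
| "sat G a (Or \<phi> \<psi>) \<longleftrightarrow> sat G a \<phi> \<or> sat G a \<psi>"
| "sat G a (Not \<phi>) \<longleftrightarrow> \<not> sat G a \<phi>"
| "sat G a (AtLeast n E \<phi>) \<longleftrightarrow>
     (\<exists>B \<subseteq> {b \<in> path_sem G E `` {a}. sat G b \<phi>}. finite B \<and> card B = n)"
| "sat G a (Eq E p) \<longleftrightarrow> path_sem G E `` {a} = path_sem G (Prop p) `` {a}"
| "sat G a (Disj E p) \<longleftrightarrow> path_sem G E `` {a} \<inter> path_sem G (Prop p) `` {a} = {}"
| "sat G a (Closed R) \<longleftrightarrow> (\<forall>p. p |\<notin>| R \<longrightarrow> path_sem G (Prop p) `` {a} = {})"

definition shape_sem :: "('n, 'p) triples \<Rightarrow> ('n, 'p) shape \<Rightarrow> 'n set" where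
  "shape_sem G \<phi> = {a. sat G a \<phi>}"

text \<open>The pair \<open>(\<phi>1, \<phi>2)\<close> stands for the inclusion of \<open>\<phi>1\<close> in \<open>\<phi>2\<close>.\<close>

type_synonym ('n, 'p) inclusions = "(('n, 'p) shape \<times> ('n, 'p) shape) set"

definition conforms :: "('n, 'p) triples \<Rightarrow> ('n, 'p) inclusions \<Rightarrow> bool" where
  "conforms G S \<longleftrightarrow> (\<forall>(\<phi>1, \<phi>2) \<in> S. shape_sem G \<phi>1 \<subseteq> shape_sem G \<phi>2)"

definition shape_schema :: "('n, 'p) inclusions \<Rightarrow> bool" where
  "shape_schema S \<longleftrightarrow> finite S \<and> (\<forall>(\<phi>1, \<phi>2) \<in> S. wf_shape \<phi>1 \<and> wf_shape \<phi>2)"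

datatype feature = FEq | FDisj | FClosed

primrec features :: "('n, 'p) shape \<Rightarrow> feature set" where
  "features Top = {}"
| "features (Const c) = {}"
| "features (And \<phi> \<psi>) = features \<phi> \<union> features \<psi>"
| "features (Or \<phi> \<psi>) = features \<phi> \<union> features \<psi>"
| "features (Not \<phi>) = features \<phi>"
| "features (AtLeast n E \<phi>) = features \<phi>"
| "features (Eq E p) = {FEq}"
| "features (Disj E p) = {FDisj}"
| "features (Closed R) = {FClosed}"

definition lang :: "feature set \<Rightarrow> ('n, 'p) inclusions set" where
  "lang F = {S. shape_schema S \<and> (\<forall>(\<phi>1, \<phi>2) \<in> S. features \<phi>1 \<subseteq> F \<and> features \<phi>2 \<subseteq> F)}"

primrec Q :: "'p \<Rightarrow> feature \<Rightarrow> ('n, 'p) triples set" where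
  "Q r FEq = {G. finite G \<and> (\<forall>a b. (a, r, b) \<in> G \<longrightarrow> (b, r, a) \<in> G)}"
| "Q r FDisj = {G. finite G \<and>
     (\<forall>a. (\<exists>b. (a, r, b) \<in> G) \<longrightarrow> (\<exists>b. (a, r, b) \<in> G \<and> (b, r, a) \<in> G))}"
| "Q r FClosed = {G. finite G \<and>
     (\<forall>a. (\<exists>b. (a, r, b) \<in> G) \<longrightarrow> (\<forall>p b. (a, p, b) \<in> G \<longrightarrow> p = r))}"

definition definable_in :: "('n, 'p) triples set \<Rightarrow> feature set \<Rightarrow> bool" where
  "definable_in C F \<longleftrightarrow> (\<exists>S \<in> lang F. \<forall>G. finite G \<longrightarrow> (conforms G S \<longleftrightarrow> G \<in> C))"

end

theory Submission
  imports Defs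
begin

text \<open>
  For \<open>closed\<close>, add an edge labelled by a property that the schema does not mention.

  For \<open>eq\<close> and \<open>disj\<close>, take graphs whose only property is \<open>r\<close> and whose \<open>r\<close>-edges form a dense
  relation on a finite set \<open>V\<close> of nodes that avoids the constants of the schema. If the degrees
  exceed the counting bounds of the schema, then a counting quantifier over a path that can take a
  step cannot tell nodes of \<open>V\<close>, or two such graphs, apart.

  For \<open>eq\<close>, compare the complete relation on \<open>V\<close> with the complete relation minus one edge. Both
  are reflexive on \<open>V\<close>, so every nonempty path meets \<open>r\<close> at every node of \<open>V\<close>.

  For \<open>disj\<close>, compare blow-ups of the circulant digraphs on the integers modulo 7 with steps
  \<open>{1, 2, 4}\<close> and \<open>{1, 2, 4, 6}\<close>. The set \<open>{1, 2, 4}\<close> is a perfect difference set whose sums also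
  cover all nonzero residues, so composing two steps in any directions relates all nodes of
  different residues. Hence a path agrees with \<open>r\<close> at a node of \<open>V\<close> only if it is trivially \<open>r\<close>.
\<close>

section \<open>Conformance and vocabulary\<close>

lemma conforms_cong:
  assumes "\<And>\<phi> \<psi> x. (\<phi>, \<psi>) \<in> S \<Longrightarrow> sat G x \<phi> = sat G' x \<phi> \<and> sat G x \<psi> = sat G' x \<psi>"
  shows "conforms G S = conforms G' S"
proof -
  have "shape_sem G \<phi> = shape_sem G' \<phi> \<and> shape_sem G \<psi> = shape_sem G' \<psi>"
    if "(\<phi>, \<psi>) \<in> S" for \<phi> \<psi>
    using assms[OF that] by (auto simp: shape_sem_def)
  then show ?thesis
    unfolding conforms_def by (fastforce split: prod.splits)
qed

text \<open>A schema contains only finitely many shapes, so the two graphs may be chosen after them.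
  If all these shapes hold at the same nodes in both graphs, the schema cannot separate the graphs
  although \<open>C\<close> does.\<close>

lemma not_definable_inI:
  assumes "\<And>T. finite T \<Longrightarrow> \<exists>G G'. finite G \<and> finite G' \<and> G \<in> C \<and> G' \<notin> C \<and>
    (\<forall>\<phi>\<in>T. features \<phi> \<subseteq> F \<longrightarrow> (\<forall>x. sat G x \<phi> = sat G' x \<phi>))"
  shows "\<not> definable_in C F"
proof
  assume "definable_in C F"
  then obtain S where S: "S \<in> lang F" and iff: "\<And>G. finite G \<Longrightarrow> conforms G S \<longleftrightarrow> G \<in> C"
    unfolding definable_in_def by blast
  define T where "T = fst ` S \<union> snd ` S"
  have "finite T" using S by (simp add: T_def lang_def shape_schema_def)
  then obtain G G' where G: "finite G" "finite G'" "G \<in> C" "G' \<notin> C"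
    and same: "\<forall>\<phi>\<in>T. features \<phi> \<subseteq> F \<longrightarrow> (\<forall>x. sat G x \<phi> = sat G' x \<phi>)"
    using assms by meson
  have "conforms G S = conforms G' S"
  proof (rule conforms_cong)
    fix \<phi> \<psi> x assume in_S: "(\<phi>, \<psi>) \<in> S"
    then have "features \<phi> \<subseteq> F" "features \<psi> \<subseteq> F" using S by (auto simp: lang_def)
    moreover have "\<phi> \<in> T" "\<psi> \<in> T" using in_S unfolding T_def by force+
    ultimately show "sat G x \<phi> = sat G' x \<phi> \<and> sat G x \<psi> = sat G' x \<psi>" using same by blast
  qed
  then show False using iff G by simp
qed

primrec max_count :: "('n, 'p) shape \<Rightarrow> nat" where
  "max_count Top = 0"
| "max_count (Const c) = 0"
| "max_count (And \<phi> \<psi>) = max (max_count \<phi>) (max_count \<psi>)"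
| "max_count (Or \<phi> \<psi>) = max (max_count \<phi>) (max_count \<psi>)"
| "max_count (Not \<phi>) = max_count \<phi>"
| "max_count (AtLeast n E \<phi>) = max n (max_count \<phi>)"
| "max_count (Eq E p) = 0"
| "max_count (Disj E p) = 0"
| "max_count (Closed R) = 0"

lemma finite_set_path: "finite (set_path E)"
  by (induction E) auto

lemma finite_set1_shape: "finite (set1_shape \<phi>)"
  by (induction \<phi>) auto

lemma finite_set2_shape: "finite (set2_shape \<phi>)"
  by (induction \<phi>) (auto simp: finite_set_path)

section \<open>Closedness\<close>

lemma path_sem_insert_fresh:
  "p \<notin> set_path E \<Longrightarrow> path_sem (insert (a, p, b) G) E = path_sem G E"
  by (induction E) auto

text \<open>Only \<open>Closed\<close> looks at properties that it does not name; every other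
  construct sees an edge only through a property occurring in the shape.\<close>

lemma sat_insert_fresh:
  assumes "p \<notin> set2_shape \<phi>" and "FClosed \<notin> features \<phi>"
  shows "sat (insert (a, p, b) G) x \<phi> = sat G x \<phi>"
  using assms by (induction \<phi> arbitrary: x) (auto simp: path_sem_insert_fresh)

lemma not_definable_closed:
  fixes r :: 'p
  assumes "infinite (UNIV :: 'p set)" and "FClosed \<notin> F"
  shows "\<not> definable_in (Q r FClosed :: ('n, 'p) triples set) F"
proof (rule not_definable_inI)
  fix T :: "('n, 'p) shape set" assume "finite T"
  then have "finite (insert r (\<Union>\<phi>\<in>T. set2_shape \<phi>))" by (simp add: finite_set2_shape)
  then obtain p where "p \<notin> insert r (\<Union>\<phi>\<in>T. set2_shape \<phi>)"
    using assms(1) ex_new_if_finite by blast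
  then have p: "p \<noteq> r" "\<And>\<phi>. \<phi> \<in> T \<Longrightarrow> p \<notin> set2_shape \<phi>" by auto
  fix a :: 'n
  \<comment> \<open>A single \<open>r\<close>-loop satisfies the closedness condition; a second loop
    at the same node with the fresh label \<open>p\<close> violates it.\<close>
  let ?G = "{(a, r, a)}"
  have "\<forall>\<phi>\<in>T. features \<phi> \<subseteq> F \<longrightarrow> (\<forall>x. sat ?G x \<phi> = sat (insert (a, p, a) ?G) x \<phi>)"
    using sat_insert_fresh p(2) assms(2) by (metis subsetD)
  moreover have "?G \<in> Q r FClosed" "insert (a, p, a) ?G \<notin> Q r FClosed" using p(1) by auto
  ultimately show "\<exists>G G'. finite G \<and> finite G' \<and> G \<in> Q r FClosed \<and> G' \<notin> Q r FClosed \<and>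
      (\<forall>\<phi>\<in>T. features \<phi> \<subseteq> F \<longrightarrow> (\<forall>x. sat G x \<phi> = sat G' x \<phi>))"
    by (intro exI[of _ ?G] exI[of _ "insert (a, p, a) ?G"]) simp
qed

section \<open>Dense graphs with a single property\<close>

definition edges :: "'p \<Rightarrow> ('n \<times> 'n) set \<Rightarrow> ('n, 'p) triples" where
  "edges r R = (\<lambda>(a, b). (a, r, b)) ` R"

lemma in_edges [simp]: "(a, p, b) \<in> edges r R \<longleftrightarrow> p = r \<and> (a, b) \<in> R"
  by (auto simp: edges_def)

lemma finite_edges: "finite R \<Longrightarrow> finite (edges r R)"
  by (simp add: edges_def)

text \<open>Reading a path as a regular expression over forward and backward properties, this is
  acceptance of the empty word.\<close>

primrec has_id :: "'p path \<Rightarrow> bool" where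
  "has_id Ident = True"
| "has_id (Prop p) = False"
| "has_id (Inv p) = False"
| "has_id (Union E1 E2) = (has_id E1 \<or> has_id E2)"
| "has_id (Comp E1 E2) = (has_id E1 \<and> has_id E2)"
| "has_id (Star E) = True"

text \<open>In the same reading: some nonempty word of the language uses only forward and backward
  \<open>r\<close>, the only letters that can match in \<open>edges r R\<close>.\<close>

primrec has_step :: "'p \<Rightarrow> 'p path \<Rightarrow> bool" where
  "has_step r Ident = False"
| "has_step r (Prop p) = (p = r)"
| "has_step r (Inv p) = (p = r)"
| "has_step r (Union E1 E2) = (has_step r E1 \<or> has_step r E2)"
| "has_step r (Comp E1 E2) = (has_step r E1 \<and> has_step r E2 \<or>
     has_step r E1 \<and> has_id E2 \<or> has_id E1 \<and> has_step r E2)"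
| "has_step r (Star E) = has_step r E"

text \<open>\<open>W\<close> lists alternative lower bounds. Steps go forward or backward, so a path
  relation can be promised to contain \<open>R0\<close> or its converse, but which one depends on
  the path.\<close>

definition covers :: "'a set set \<Rightarrow> 'a set \<Rightarrow> bool" where
  "covers W S \<longleftrightarrow> (\<exists>Z\<in>W. Z \<subseteq> S)"

lemma covers_mono: "covers W S \<Longrightarrow> S \<subseteq> S' \<Longrightarrow> covers W S'"
  unfolding covers_def by (meson order_trans)

lemma coversI: "Z \<in> W \<Longrightarrow> Z \<subseteq> S \<Longrightarrow> covers W S"
  unfolding covers_def by (rule bexI)

lemma coversE:
  assumes "covers W S"
  obtains Z where "Z \<in> W" "Z \<subseteq> S"
  using assms unfolding covers_def by (elim bexE)

text \<open>The core \<open>R0\<close> carries the lower bounds and may be smaller than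
  \<open>R\<close>, so that two graphs can share it. By \<open>comp\<close>, composing never loses
  the core or its converse, so a path of any length that takes steps keeps degree at least
  \<open>m\<close>.\<close>

locale dense_relation =
  fixes r :: 'p and V :: "'n set" and R0 R :: "('n \<times> 'n) set" and m :: nat
  assumes finite_V: "finite V" and m_pos: "0 < m"
    and R0_subset: "R0 \<subseteq> R" and R_subset: "R \<subseteq> V \<times> V"
    and deg_out: "x \<in> V \<Longrightarrow> m \<le> card (R0 `` {x})"
    and deg_in: "x \<in> V \<Longrightarrow> m \<le> card (R0\<inverse> `` {x})"
    and comp: "X \<in> {R0, R0\<inverse>} \<Longrightarrow> Y \<in> {R0, R0\<inverse>} \<Longrightarrow> covers {R0, R0\<inverse>} (X O Y)"
begin

abbreviation sem :: "'p path \<Rightarrow> ('n \<times> 'n) set" where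
  "sem \<equiv> path_sem (edges r R)"

lemma sem_id: "has_id E \<Longrightarrow> Id \<subseteq> sem E"
  by (induction E) auto

lemma sem_upper:
  "sem E \<subseteq> (if has_id E then Id else {}) \<union> (if has_step r E then V \<times> V else {})"
proof (induction E)
  case (Comp E1 E2)
  then show ?case by (auto split: if_splits)
next
  case (Star E)
  let ?U = "Id \<union> (if has_step r E then V \<times> V else {})"
  have "trans ?U" by (auto simp: trans_def)
  have "sem E \<subseteq> ?U" using Star by (auto split: if_splits)
  then have "(sem E)\<^sup>* \<subseteq> ?U\<^sup>*" by (rule rtrancl_mono)
  also have "?U\<^sup>* = ?U"
    using trancl_id[OF \<open>trans ?U\<close>] rtrancl_trancl_reflcl[of ?U] by auto
  finally show ?case by simp
qed (use R_subset in \<open>auto split: if_splits\<close>)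

text \<open>Two stepping factors are handled by \<open>comp\<close>; if only one factor need step,
  the other contains the identity and so removes nothing.\<close>

lemma sem_lower: "has_step r E \<Longrightarrow> covers {R0, R0\<inverse>} (sem E)"
proof (induction E)
  case Ident
  then show ?case by simp
next
  case (Prop p)
  then have "R0 \<subseteq> sem (Prop p)" using R0_subset by auto
  then show ?case by (rule coversI[rotated]) simp
next
  case (Inv p)
  then have "R0\<inverse> \<subseteq> sem (Inv p)" using R0_subset by auto
  then show ?case by (rule coversI[rotated]) simp
next
  case (Union E1 E2)
  then show ?case by (auto elim: covers_mono)
next
  case (Comp E1 E2)
  from Comp.prems consider "has_step r E1" "has_step r E2" | "has_step r E1" "has_id E2"
    | "has_id E1" "has_step r E2" by auto
  then show ?case
  proof cases
    case 1
    obtain X where X: "X \<in> {R0, R0\<inverse>}" "X \<subseteq> sem E1" using Comp.IH(1)[OF 1(1)] by (rule coversE)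
    obtain Y where Y: "Y \<in> {R0, R0\<inverse>}" "Y \<subseteq> sem E2" using Comp.IH(2)[OF 1(2)] by (rule coversE)
    have "X O Y \<subseteq> sem (path.Comp E1 E2)" using X(2) Y(2) by (simp add: relcomp_mono)
    then show ?thesis by (rule covers_mono[OF comp[OF X(1) Y(1)]])
  next
    case 2
    have "sem E1 \<subseteq> sem (path.Comp E1 E2)" using sem_id[OF 2(2)] by auto
    then show ?thesis by (rule covers_mono[OF Comp.IH(1)[OF 2(1)]])
  next
    case 3
    have "sem E2 \<subseteq> sem (path.Comp E1 E2)" using sem_id[OF 3(1)] by auto
    then show ?thesis by (rule covers_mono[OF Comp.IH(2)[OF 3(2)]])
  qed
next
  case (Star E)
  have "sem E \<subseteq> sem (path.Star E)" by auto
  moreover have "covers {R0, R0\<inverse>} (sem E)" using Star by simp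
  ultimately show ?case by (rule covers_mono[rotated])
qed

lemma sem_image_trivial:
  "x \<notin> V \<or> \<not> has_step r E \<Longrightarrow> sem E `` {x} = (if has_id E then {x} else {})"
  using sem_upper[of E] sem_id[of E] by (auto split: if_splits)

lemma sem_image_step:
  assumes "x \<in> V" and "has_step r E"
  shows "sem E `` {x} \<subseteq> V" and "m \<le> card (sem E `` {x})"
proof -
  show sub: "sem E `` {x} \<subseteq> V" using sem_upper[of E] assms(1) by (auto split: if_splits)
  obtain Z where Z: "Z \<in> {R0, R0\<inverse>}" "Z \<subseteq> sem E" using sem_lower[OF assms(2)] by (rule coversE)
  have "m \<le> card (Z `` {x})" using Z(1) deg_out[OF assms(1)] deg_in[OF assms(1)] by auto
  also have "\<dots> \<le> card (sem E `` {x})"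
    using finite_subset[OF sub finite_V] Z(2) by (intro card_mono) auto
  finally show "m \<le> card (sem E `` {x})" .
qed

text \<open>From a node of \<open>V\<close>, a stepping path reaches at least \<open>m\<close>
  nodes, all in \<open>V\<close> and hence all with truth value \<open>t\<close>: enough witnesses
  or none. In every other case the path reaches at most its own start.\<close>

lemma sat_AtLeast_dense:
  assumes const: "\<And>y. y \<in> V \<Longrightarrow> sat (edges r R) y \<phi> = t" and "n \<le> m"
  shows "sat (edges r R) x (AtLeast n E \<phi>) \<longleftrightarrow>
    n = 0 \<or> (if x \<in> V \<and> has_step r E then t else n = 1 \<and> has_id E \<and> sat (edges r R) x \<phi>)"
proof (cases "x \<in> V \<and> has_step r E")
  case True
  then have T: "x \<in> V" "has_step r E" by auto
  have "sat (edges r R) y \<phi> = t" if "y \<in> sem E `` {x}" for y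
    using sem_image_step(1)[OF T] that by (intro const) (rule subsetD)
  then have filter: "{b \<in> sem E `` {x}. sat (edges r R) b \<phi>} = (if t then sem E `` {x} else {})"
    by (cases t) auto
  obtain B where B: "B \<subseteq> sem E `` {x}" "card B = n" "finite B"
    using order_trans[OF \<open>n \<le> m\<close> sem_image_step(2)[OF T]] by (rule obtain_subset_with_card_n)
  have "(\<exists>B\<subseteq>(if t then sem E `` {x} else {}). finite B \<and> card B = n) \<longleftrightarrow> n = 0 \<or> t"
    using B by (cases t) (simp, blast, auto)
  then show ?thesis unfolding sat.simps(6) filter if_P[OF True] .
next
  case False
  then have "sem E `` {x} = (if has_id E then {x} else {})"
    by (intro sem_image_trivial) blast
  then have filter: "{b \<in> sem E `` {x}. sat (edges r R) b \<phi>} =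
      (if has_id E \<and> sat (edges r R) x \<phi> then {x} else {})"
    by auto
  have "(\<exists>B\<subseteq>(if q then {x} else {}). finite B \<and> card B = n) \<longleftrightarrow> n = 0 \<or> n = 1 \<and> q" for q
    by (cases q) (auto simp: subset_singleton_iff conj_disj_distribR ex_disj_distrib)
  then show ?thesis unfolding sat.simps(6) filter if_not_P[OF False] by simp
qed

lemma R_image_nonempty:
  assumes "x \<in> V"
  shows "R `` {x} \<noteq> {}"
proof -
  have "card (R0 `` {x}) \<noteq> 0" using deg_out[OF assms] m_pos by simp
  then have "R0 `` {x} \<noteq> {}" by force
  then show ?thesis using R0_subset by blast
qed

lemma sat_Closed_dense: "sat (edges r R) x (Closed P) \<longleftrightarrow> x \<notin> V \<or> r |\<in>| P"
  using R_image_nonempty[of x] R_subset by auto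

end

text \<open>
  Truth values of the atoms \<open>eq\<close> and \<open>disj\<close> are supplied by \<open>w\<close>, which may look only at
  membership in \<open>V\<close>, not at the graph.
\<close>

lemma sat_dense_cong:
  fixes \<phi> :: "('n, 'p) shape"
  assumes dense: "dense_relation V R0 R m" "dense_relation V R0' R' m"
    and atoms: "\<And>S E p x. S \<in> {R, R'} \<Longrightarrow> FEq \<in> F \<Longrightarrow>
        sat (edges r S) x (Eq E p) = w (Eq E p) (x \<in> V)"
      "\<And>S E p x. S \<in> {R, R'} \<Longrightarrow> FDisj \<in> F \<Longrightarrow>
        sat (edges r S) x (Disj E p) = w (Disj E p) (x \<in> V)"
    and "max_count \<phi> \<le> m" "set1_shape \<phi> \<inter> V = {}" "features \<phi> \<subseteq> F"
  shows "sat (edges r R) x \<phi> = sat (edges r R') x \<phi>"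
proof -
  interpret A: dense_relation r V R0 R m by fact
  interpret B: dense_relation r V R0' R' m by fact
  \<comment> \<open>Agreement of the two graphs alone does not pass through a counting quantifier,
    since the reachable sets differ. The induction therefore also carries constancy on
    \<open>V\<close>; outside \<open>V\<close> the value may vary with the node.\<close>
  define uniform where "uniform \<psi> t \<longleftrightarrow> (\<forall>x. sat (edges r R) x \<psi> = sat (edges r R') x \<psi>) \<and>
      (\<forall>x\<in>V. sat (edges r R) x \<psi> = t)" for \<psi> t
  have uniformI: "uniform \<psi> t"
    if "\<And>x. sat (edges r R) x \<psi> = sat (edges r R') x \<psi>"
      and "\<And>x. x \<in> V \<Longrightarrow> sat (edges r R) x \<psi> = t" for \<psi> t
    using that unfolding uniform_def by blast
  have same: "sat (edges r R) x \<psi> = sat (edges r R') x \<psi>" if "uniform \<psi> t" for \<psi> t x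
    using that unfolding uniform_def by blast
  have const: "sat (edges r R) x \<psi> = t" if "uniform \<psi> t" "x \<in> V" for \<psi> t x
    using that unfolding uniform_def by blast
  have const': "sat (edges r R') x \<psi> = t" if "uniform \<psi> t" "x \<in> V" for \<psi> t x
    using const[OF that] same[OF that(1)] by simp
  have "\<exists>t. uniform \<phi> t"
    using assms(5-7)
  proof (induction \<phi>)
    case Top
    have "uniform Top True" by (rule uniformI) simp_all
    then show ?case ..
  next
    case (Const c)
    have "uniform (Const c) False" by (rule uniformI) (use Const in auto)
    then show ?case ..
  next
    case (And \<phi> \<psi>)
    then obtain t u where "uniform \<phi> t" "uniform \<psi> u" by auto
    then have "uniform (And \<phi> \<psi>) (t \<and> u)"
      by (intro uniformI) (simp_all add: same const')
    then show ?case ..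
  next
    case (Or \<phi> \<psi>)
    then obtain t u where "uniform \<phi> t" "uniform \<psi> u" by auto
    then have "uniform (Or \<phi> \<psi>) (t \<or> u)"
      by (intro uniformI) (simp_all add: same const')
    then show ?case ..
  next
    case (Not \<phi>)
    then obtain t where "uniform \<phi> t" by auto
    then have "uniform (Not \<phi>) (\<not> t)"
      by (intro uniformI) (simp_all add: same const')
    then show ?case ..
  next
    case (AtLeast n E \<phi>)
    then obtain t where t: "uniform \<phi> t" by auto
    have n: "n \<le> m" using AtLeast.prems by simp
    note A = A.sat_AtLeast_dense[OF const[OF t] n]
    note B = B.sat_AtLeast_dense[OF const'[OF t] n]
    have "uniform (AtLeast n E \<phi>) (n = 0 \<or> (if has_step r E then t else n = 1 \<and> has_id E \<and> t))"
      by (rule uniformI) (simp_all only: A B same[OF t] const'[OF t] simp_thms)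
    then show ?case ..
  next
    case (Eq E p)
    then have "FEq \<in> F" by simp
    then have "uniform (Eq E p) (w (Eq E p) True)"
      by (intro uniformI) (simp_all add: atoms(1) del: sat.simps)
    then show ?case ..
  next
    case (Disj E p)
    then have "FDisj \<in> F" by simp
    then have "uniform (Disj E p) (w (Disj E p) True)"
      by (intro uniformI) (simp_all add: atoms(2) del: sat.simps)
    then show ?case ..
  next
    case (Closed P)
    have "uniform (Closed P) (r |\<in>| P)"
      by (intro uniformI) (simp_all add: A.sat_Closed_dense B.sat_Closed_dense del: sat.simps)
    then show ?case ..
  qed
  then show ?thesis using same by blast
qed

section \<open>Counting bounds and fresh nodes for finitely many shapes\<close>

lemma max_count_bounded:
  assumes "finite T"
  obtains m where "0 < m" and "\<And>\<phi>. \<phi> \<in> T \<Longrightarrow> max_count \<phi> \<le> m"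
proof
  show "max_count \<phi> \<le> Suc (\<Sum>\<phi>\<in>T. max_count \<phi>)" if "\<phi> \<in> T" for \<phi>
    using member_le_sum[OF that, of max_count] assms by simp
qed simp

lemma fresh_nodes:
  fixes T :: "('n, 'p) shape set"
  assumes "infinite (UNIV :: 'n set)" and "finite T"
  obtains V where "finite V" "card V = k" "\<And>\<phi>. \<phi> \<in> T \<Longrightarrow> set1_shape \<phi> \<inter> V = {}"
proof -
  have "infinite (- (\<Union>\<phi>\<in>T. set1_shape \<phi>))"
    using assms by (simp add: Compl_eq_Diff_UNIV finite_set1_shape)
  then obtain V where "finite V" "card V = k" "V \<subseteq> - (\<Union>\<phi>\<in>T. set1_shape \<phi>)"
    using infinite_arbitrarily_large by metis
  then show thesis by (intro that) blast+
qed

section \<open>Equality\<close>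

text \<open>The core is all of \<open>R\<close>. Reflexivity on \<open>V\<close> allows the second
  factor of a composition to stand still, so \<open>X O Y\<close> contains \<open>X\<close>.\<close>

lemma dense_reflexive:
  assumes "finite V" "0 < m" "R \<subseteq> V \<times> V" "\<And>x. x \<in> V \<Longrightarrow> (x, x) \<in> R"
    "\<And>x. x \<in> V \<Longrightarrow> m \<le> card (R `` {x})" "\<And>x. x \<in> V \<Longrightarrow> m \<le> card (R\<inverse> `` {x})"
  shows "dense_relation V R R m"
proof
  fix X Y assume X: "X \<in> {R, R\<inverse>}" and Y: "Y \<in> {R, R\<inverse>}"
  then have "X \<subseteq> V \<times> V" using assms(3) by auto
  then have "X \<subseteq> X O Y" using Y assms(4) by auto
  then show "covers {R, R\<inverse>} (X O Y)" by (rule coversI[OF X])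
qed (use assms in auto)

text \<open>At a node \<open>x\<close> of \<open>V\<close>, both \<open>r\<close> and every path
  that is empty or can step relate \<open>x\<close> to itself, so disjointness from \<open>r\<close>
  fails. The criterion mentions \<open>R\<close> nowhere and can serve as \<open>w\<close> in
  \<open>sat_dense_cong\<close>.\<close>

lemma sat_Disj_reflexive:
  assumes "dense_relation V R R m" and refl: "\<And>x. x \<in> V \<Longrightarrow> (x, x) \<in> R"
  shows "sat (edges r R) x (Disj E p) \<longleftrightarrow> x \<in> V \<longrightarrow> p = r \<longrightarrow> \<not> (has_id E \<or> has_step r E)"
proof -
  interpret dense_relation r V R R m by fact
  show ?thesis
  proof (cases "x \<in> V \<and> p = r")
    case True
    have "(x, x) \<in> sem E" if "has_id E \<or> has_step r E"
      using that
    proof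
      assume "has_step r E"
      then obtain Z where "Z \<in> {R, R\<inverse>}" "Z \<subseteq> sem E" using sem_lower coversE by meson
      then show ?thesis using refl[of x] True by auto
    qed (use sem_id in blast)
    moreover have "sem E `` {x} = {}" if "\<not> (has_id E \<or> has_step r E)"
      using that sem_image_trivial[of x E] by simp
    ultimately show ?thesis using True refl[of x] by auto
  next
    case False
    then show ?thesis using R_subset by auto
  qed
qed

lemma not_definable_eq:
  fixes r :: 'p
  assumes "infinite (UNIV :: 'n set)" and "FEq \<notin> F"
  shows "\<not> definable_in (Q r FEq :: ('n, 'p) triples set) F"
proof (rule not_definable_inI)
  fix T :: "('n, 'p) shape set" assume T: "finite T"
  obtain m where m: "0 < m" and count: "\<And>\<phi>. \<phi> \<in> T \<Longrightarrow> max_count \<phi> \<le> m"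
    using max_count_bounded[OF T] by metis
  \<comment> \<open>One node more than \<open>m\<close>, since deleting an edge costs its endpoints
    one neighbour in one direction.\<close>
  obtain V where V: "finite V" "card V = Suc m" "\<And>\<phi>. \<phi> \<in> T \<Longrightarrow> set1_shape \<phi> \<inter> V = {}"
    using fresh_nodes[OF assms(1) T] by metis
  have "\<not> card V \<le> Suc 0" using V(2) m by simp
  then obtain a b where ab: "a \<in> V" "b \<in> V" "a \<noteq> b"
    using V(1) card_le_Suc0_iff_eq by blast
  \<comment> \<open>Deleting \<open>(a, b)\<close> but not \<open>(b, a)\<close> breaks symmetry; as
    \<open>a\<close> and \<open>b\<close> differ, all loops survive.\<close>
  let ?R = "V \<times> V" and ?R' = "V \<times> V - {(a, b)}"
  have m_le: "m \<le> card W" if "V - {c} \<subseteq> W" "W \<subseteq> V" for c W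
  proof -
    have "card V - 1 \<le> card (V - {c})" by (simp add: V(1) card_Diff_singleton_if)
    also have "\<dots> \<le> card W" using that V(1) by (meson card_mono finite_subset)
    finally show ?thesis using V(2) by simp
  qed
  have dense: "dense_relation V S S m" if "S \<in> {?R, ?R'}" for S
  proof (rule dense_reflexive)
    fix x assume "x \<in> V"
    then have "V - {b} \<subseteq> S `` {x}" "S `` {x} \<subseteq> V"
      and "V - {a} \<subseteq> S\<inverse> `` {x}" "S\<inverse> `` {x} \<subseteq> V"
      using that by auto
    then show "m \<le> card (S `` {x})" "m \<le> card (S\<inverse> `` {x})"
      by (blast intro: m_le)+
  qed (use that V(1) ab m in auto)
  have "sat (edges r ?R) x \<phi> = sat (edges r ?R') x \<phi>" if "\<phi> \<in> T" "features \<phi> \<subseteq> F" for \<phi> x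
  \<comment> \<open>Atoms \<open>Eq\<close> are excluded by \<open>F\<close>, so \<open>w\<close>
    may be \<open>undefined\<close> there.\<close>
  proof (rule sat_dense_cong[OF dense dense, where F = F and w = "\<lambda>\<psi> q. case \<psi> of Disj E p \<Rightarrow>
        q \<longrightarrow> p = r \<longrightarrow> \<not> (has_id E \<or> has_step r E) | _ \<Rightarrow> undefined"])
    fix S E p x assume S: "S \<in> {?R, ?R'}"
    then have refl: "(y, y) \<in> S" if "y \<in> V" for y using ab that by auto
    show "sat (edges r S) x (Disj E p) = (case Disj E p of Disj E p \<Rightarrow>
        x \<in> V \<longrightarrow> p = r \<longrightarrow> \<not> (has_id E \<or> has_step r E) | _ \<Rightarrow> undefined)"
      by (simp add: sat_Disj_reflexive[OF dense[OF S] refl] del: sat.simps)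
  next
    show "max_count \<phi> \<le> m" using count[OF that(1)] .
    show "set1_shape \<phi> \<inter> V = {}" using V(3)[OF that(1)] .
  qed (use assms(2) that(2) in simp_all)
  moreover have "edges r ?R \<in> Q r FEq" "edges r ?R' \<notin> Q r FEq"
    using V(1) ab by (auto simp: finite_edges)
  ultimately show "\<exists>G G'. finite G \<and> finite G' \<and> G \<in> Q r FEq \<and> G' \<notin> Q r FEq \<and>
      (\<forall>\<phi>\<in>T. features \<phi> \<subseteq> F \<longrightarrow> (\<forall>x. sat G x \<phi> = sat G' x \<phi>))"
    using V(1) by (intro exI[of _ "edges r ?R"] exI[of _ "edges r ?R'"]) (simp add: finite_edges)
qed

section \<open>Disjointness\<close>

text \<open>
  If a path can take a step but is not \<open>off_prop\<close>, it is exactly \<open>r\<close>, up to the identity.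
\<close>

primrec off_prop :: "'p \<Rightarrow> 'p path \<Rightarrow> bool" where
  "off_prop r Ident = False"
| "off_prop r (Prop p) = False"
| "off_prop r (Inv p) = (p = r)"
| "off_prop r (Union E1 E2) = (off_prop r E1 \<or> off_prop r E2)"
| "off_prop r (Comp E1 E2) = (has_step r E1 \<and> has_step r E2 \<or>
     off_prop r E1 \<and> has_id E2 \<or> has_id E1 \<and> off_prop r E2)"
| "off_prop r (Star E) = has_step r E"

text \<open>\<open>A\<close> is contained in every composition of two steps, whatever their
  directions. At no node of \<open>V\<close> does \<open>A\<close> or the converse of
  \<open>R\<close> fit inside \<open>R\<close>, so containing either one exposes a path as different
  from \<open>r\<close>.\<close>

locale mixing_relation = dense_relation +
  fixes A :: "('b \<times> 'b) set"
  assumes comp_A: "X \<in> {R0, R0\<inverse>} \<Longrightarrow> Y \<in> {R0, R0\<inverse>} \<Longrightarrow> A \<subseteq> X O Y"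
    and irrefl: "(x, x) \<notin> R"
    and A_off: "x \<in> V \<Longrightarrow> \<not> A `` {x} \<subseteq> R `` {x}"
    and converse_off: "x \<in> V \<Longrightarrow> \<not> R\<inverse> `` {x} \<subseteq> R `` {x}"
begin

lemma sem_two_steps:
  assumes "has_step r E1" "has_step r E2"
  shows "A \<subseteq> sem E1 O sem E2"
proof -
  obtain X where X: "X \<in> {R0, R0\<inverse>}" "X \<subseteq> sem E1" using sem_lower[OF assms(1)] by (rule coversE)
  obtain Y where Y: "Y \<in> {R0, R0\<inverse>}" "Y \<subseteq> sem E2" using sem_lower[OF assms(2)] by (rule coversE)
  show ?thesis using comp_A[OF X(1) Y(1)] relcomp_mono[OF X(2) Y(2)] by (rule order_trans)
qed

text \<open>A path deviates from \<open>r\<close> by a backward step, which yields the converse of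
  \<open>R\<close>, or by two consecutive steps, which yield \<open>A\<close>.\<close>

lemma sem_off: "off_prop r E \<Longrightarrow> covers {R\<inverse>, A} (sem E)"
proof (induction E)
  case (Inv p)
  then have "R\<inverse> \<subseteq> sem (Inv p)" by auto
  then show ?case by (rule coversI[rotated]) simp
next
  case (Union E1 E2)
  then show ?case by (auto elim: covers_mono)
next
  case (Comp E1 E2)
  from Comp.prems consider "has_step r E1" "has_step r E2" | "off_prop r E1" "has_id E2"
    | "has_id E1" "off_prop r E2" by auto
  then show ?case
  proof cases
    case 1
    then have "A \<subseteq> sem (path.Comp E1 E2)" using sem_two_steps by simp
    then show ?thesis by (rule coversI[rotated]) simp
  next
    case 2
    have "sem E1 \<subseteq> sem (path.Comp E1 E2)" using sem_id[OF 2(2)] by auto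
    then show ?thesis by (rule covers_mono[OF Comp.IH(1)[OF 2(1)]])
  next
    case 3
    have "sem E2 \<subseteq> sem (path.Comp E1 E2)" using sem_id[OF 3(1)] by auto
    then show ?thesis by (rule covers_mono[OF Comp.IH(2)[OF 3(2)]])
  qed
next
  case (Star E)
  then have "A \<subseteq> sem E O sem E" using sem_two_steps by simp
  also have "\<dots> \<subseteq> sem (path.Star E)" by (auto intro: rtrancl_trans)
  finally show ?case by (rule coversI[rotated]) simp
qed simp_all

lemma sem_no_step: "\<not> has_step r E \<Longrightarrow> sem E = (if has_id E then Id else {})"
  using sem_upper[of E] sem_id[of E] by auto

lemma sem_not_off:
  "\<not> off_prop r E \<Longrightarrow> sem E = (if has_id E then Id else {}) \<union> (if has_step r E then R else {})"
proof (induction E)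
  case (Comp E1 E2)
  \<comment> \<open>At most one factor can step, as two would make the composition
    \<open>off_prop\<close>; a factor without steps is the identity or empty.\<close>
  then show ?case
    using sem_no_step[of E1] sem_no_step[of E2] by (cases "has_step r E1"; cases "has_step r E2") auto
next
  case (Star E)
  then show ?case using sem_no_step[of "path.Star E"] by simp
qed auto

text \<open>An \<open>off_prop\<close> path leaves the \<open>r\<close>-successors by
  \<open>sem_off\<close>, and the identity leaves them because \<open>R\<close> is irreflexive. A
  path that cannot step reaches at most \<open>x\<close>, which never equals the nonempty successor
  set of a node of \<open>V\<close>. Again the criterion does not depend on
  \<open>R\<close>.\<close>

lemma sat_Eq_mixing:
  "sat (edges r R) x (Eq E p) \<longleftrightarrow> (if x \<in> V \<and> has_step r E
     then p = r \<and> \<not> off_prop r E \<and> \<not> has_id E else \<not> has_id E \<and> (x \<in> V \<longrightarrow> p \<noteq> r))"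
proof (cases "x \<in> V \<and> has_step r E")
  case True
  have ne: "sem E `` {x} \<noteq> {}" using sem_image_step[of x E] True m_pos by fastforce
  have "sem E `` {x} = R `` {x} \<longleftrightarrow> \<not> off_prop r E \<and> \<not> has_id E"
  proof (cases "off_prop r E \<or> has_id E")
    case off: True
    have "\<not> sem E `` {x} \<subseteq> R `` {x}"
      using off
    proof
      assume "off_prop r E"
      then obtain Z where Z: "Z \<in> {R\<inverse>, A}" "Z \<subseteq> sem E" using sem_off coversE by meson
      then have "\<not> Z `` {x} \<subseteq> R `` {x}" using A_off[of x] converse_off[of x] True by auto
      then show ?thesis using Z(2) by blast
    next
      assume "has_id E"
      then show ?thesis using sem_id[of E] irrefl[of x] by blast
    qed
    then show ?thesis using off by blast
  next
    case False
    then show ?thesis using sem_not_off[of E] True by auto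
  qed
  then show ?thesis using True ne by auto
next
  case False
  have "R `` {x} = {}" if "x \<notin> V" using that R_subset by blast
  then show ?thesis
    using False sem_image_trivial[of x E] R_image_nonempty[of x] irrefl[of x] by auto
qed

end

section \<open>Circulant digraphs modulo 7\<close>

text \<open>Adding 7 before subtracting avoids truncation on the natural numbers; the residue is
  that of \<open>j - i\<close>.\<close>

definition circulant :: "nat set \<Rightarrow> (nat \<times> nat) set" where
  "circulant D = {(i, j). i < 7 \<and> j < 7 \<and> (j + 7 - i) mod 7 \<in> D}"

definition blow_up :: "'n set \<Rightarrow> ('n \<Rightarrow> nat) \<Rightarrow> (nat \<times> nat) set \<Rightarrow> ('n \<times> 'n) set" where
  "blow_up V c H = {(x, y). x \<in> V \<and> y \<in> V \<and> (c x, c y) \<in> H}"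

lemma blow_up_converse: "(blow_up V c H)\<inverse> = blow_up V c (H\<inverse>)"
  by (auto simp: blow_up_def)

lemma finite_blow_up: "finite V \<Longrightarrow> finite (blow_up V c H)"
  by (rule finite_subset[of _ "V \<times> V"]) (auto simp: blow_up_def)

text \<open>\<open>s\<close> and \<open>t\<close> are true for forward steps. Equal directions use
  the sums 4+4, 1+1, 1+2, 2+2, 1+4, 2+4, which give 1 to 6 modulo 7, or their negatives; opposite
  directions use differences. Quantifying over lists lets \<open>code_simp\<close> evaluate the
  claim.\<close>

lemma two_steps_mod_7:
  "\<forall>s\<in>set [True, False]. \<forall>t\<in>set [True, False]. \<forall>i\<in>set [0..<7]. \<forall>j\<in>set [0..<7]. i \<noteq> j \<longrightarrow>
    (\<exists>k\<in>set [0..<7]. (if s then k + 7 - i else i + 7 - k) mod 7 \<in> {1, 2, 4::nat} \<and>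
      (if t then j + 7 - k else k + 7 - j) mod 7 \<in> {1, 2, 4::nat})"
  by code_simp

text \<open>The quadratic residues 1, 2, 4 and their negatives 6, 5, 3 are disjoint: this is the
  Paley tournament on seven vertices.\<close>

lemma antisym_mod_7:
  "\<forall>i\<in>set [0..<7]. \<forall>j\<in>set [0..<7]. (j + 7 - i) mod 7 \<in> {1, 2, 4::nat} \<longrightarrow>
    (i + 7 - j) mod 7 \<notin> {1, 2, 4::nat}"
  by code_simp

lemma circulant_antisym:
  assumes "(i, j) \<in> circulant {1, 2, 4}"
  shows "(j, i) \<notin> circulant {1, 2, 4}"
proof
  assume "(j, i) \<in> circulant {1, 2, 4}"
  then have "i \<in> set [0..<7]" "j \<in> set [0..<7]" "(i + 7 - j) mod 7 \<in> {1, 2, 4}"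
    by (auto simp: circulant_def)
  moreover have "(j + 7 - i) mod 7 \<in> {1, 2, 4}" using assms by (auto simp: circulant_def)
  ultimately show False using antisym_mod_7 by blast
qed

lemma circulant_comp:
  assumes "X \<in> {circulant {1, 2, 4}, (circulant {1, 2, 4})\<inverse>}"
    and "Y \<in> {circulant {1, 2, 4}, (circulant {1, 2, 4})\<inverse>}"
  shows "circulant {1..6} \<subseteq> X O Y"
proof
  define step where
    "step s = (if s then circulant {1, 2, 4} else (circulant {1, 2, 4})\<inverse>)" for s
  have step: "(i, j) \<in> step s"
    if "i < 7" "j < 7" "(if s then j + 7 - i else i + 7 - j) mod 7 \<in> {1, 2, 4}" for s i j
    using that by (cases s) (simp_all only: step_def circulant_def if_True if_False
        converse_iff mem_Collect_eq prod.case simp_thms)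
  obtain s t where st: "X = step s" "Y = step t"
    using assms by (metis (full_types) insertE singletonD step_def)
  fix e assume "e \<in> circulant {1..6}"
  then obtain i j where e: "e = (i, j)" "i < 7" "j < 7" and "(j + 7 - i) mod 7 \<noteq> 0"
    by (auto simp: circulant_def)
  then have "i \<noteq> j" by auto
  have "i \<in> set [0..<7]" "j \<in> set [0..<7]" "s \<in> set [True, False]" "t \<in> set [True, False]"
    using e(2,3) by auto
  then obtain k where "k \<in> set [0..<7]"
    "(if s then k + 7 - i else i + 7 - k) mod 7 \<in> {1, 2, 4::nat}"
    "(if t then j + 7 - k else k + 7 - j) mod 7 \<in> {1, 2, 4::nat}"
    using two_steps_mod_7 \<open>i \<noteq> j\<close> by meson
  then have "(i, k) \<in> X" "(k, j) \<in> Y"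
    using step[of i k s] step[of k j t] e(2,3) st by simp_all
  then show "e \<in> X O Y" using e(1) by (simp add: relcompI)
qed

lemma diff_mod_7:
  fixes i d :: nat
  assumes "i < 7" "0 < d" "d < 7"
  shows "((i + d) mod 7 + 7 - i) mod 7 = d"
proof -
  have "(i + d) mod 7 = (if i + d < 7 then i + d else i + d - 7)"
    using assms by (simp add: mod_if)
  then show ?thesis using assms by (simp split: if_splits)
qed

lemma add_mod_7_inverse:
  fixes i d :: nat
  assumes "i < 7" "d < 7"
  shows "((i + d) mod 7 + (7 - d)) mod 7 = i"
proof -
  have "((i + d) mod 7 + (7 - d)) mod 7 = (i + d + (7 - d)) mod 7" by (rule mod_add_left_eq)
  also have "i + d + (7 - d) = i + 7" using assms(2) by simp
  finally show ?thesis using assms(1) by simp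
qed

lemma circulant_succ:
  assumes "i < 7" and "0 < d" "d < 7" "d \<in> D"
  shows "(i, (i + d) mod 7) \<in> circulant D"
  using assms diff_mod_7[OF assms(1-3)] by (simp add: circulant_def)

lemma circulant_pred:
  assumes "i < 7" and "0 < d" "d < 7" "7 - d \<in> D"
  shows "((i + d) mod 7, i) \<in> circulant D"
  using circulant_succ[of "(i + d) mod 7" "7 - d" D] add_mod_7_inverse[of i d] assms by simp

section \<open>Blow-ups of the circulants with equal fibres\<close>

lemma equitable_colouring:
  assumes "finite V" and "card V = k * m"
  obtains c :: "'a \<Rightarrow> nat" where "\<And>x. x \<in> V \<Longrightarrow> c x < k"
    and "\<And>i. i < k \<Longrightarrow> card {x \<in> V. c x = i} = m"
proof -
  have "finite ({..<k} \<times> {..<m})" "card V = card ({..<k} \<times> {..<m})" using assms(2) by simp_all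
  from finite_same_card_bij[OF assms(1) this] obtain g where g: "bij_betw g V ({..<k} \<times> {..<m})" ..
  show thesis
  proof (rule that[of "\<lambda>x. fst (g x)"])
    fix x assume "x \<in> V"
    then have "g x \<in> {..<k} \<times> {..<m}" using bij_betw_apply[OF g] by simp
    then show "fst (g x) < k" by auto
  next
    fix i assume "i < k"
    let ?W = "{x \<in> V. fst (g x) = i}"
    have "g ` ?W = g ` V \<inter> {y. fst y = i}" by blast
    also have "\<dots> = {i} \<times> {..<m}"
      unfolding bij_betw_imp_surj_on[OF g] using \<open>i < k\<close> by auto
    finally have "g ` ?W = {i} \<times> {..<m}" .
    moreover have "inj_on g ?W"
      by (rule inj_on_subset[OF bij_betw_imp_inj_on[OF g]]) blast
    ultimately have "card ?W = card ({i} \<times> {..<m})" using card_image[of g ?W] by simp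
    then show "card ?W = m" by simp
  qed
qed

lemma mixing_blow_up:
  assumes V: "finite V" "0 < m" "\<And>x. x \<in> V \<Longrightarrow> c x < 7"
    and fibre: "\<And>i. i < 7 \<Longrightarrow> card {x \<in> V. c x = i} = m"
    and D: "D \<in> {{1, 2, 4}, {1, 2, 4, 6}}"
  shows "mixing_relation V (blow_up V c (circulant {1, 2, 4})) (blow_up V c (circulant D)) m
    (blow_up V c (circulant {1..6}))"
proof -
  let ?H = "circulant {1, 2, 4}"
  have ex: "\<exists>x\<in>V. c x = i" if "i < 7" for i
    using fibre[OF that] V(2) by (metis (mono_tags, lifting) card.empty empty_Collect_eq less_irrefl)
  have comp_blow_up: "blow_up V c (X O Y) \<subseteq> blow_up V c X O blow_up V c Y"
    if "X \<in> {?H, ?H\<inverse>}" for X Y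
  proof
    fix e assume "e \<in> blow_up V c (X O Y)"
    then obtain x y k where e: "e = (x, y)" "x \<in> V" "y \<in> V" "(c x, k) \<in> X" "(k, c y) \<in> Y"
      by (auto simp: blow_up_def)
    \<comment> \<open>The intermediate colour must be a residue, so that its fibre supplies an
      actual node of \<open>V\<close>.\<close>
    moreover have "k < 7" using e(4) that by (auto simp: circulant_def)
    ultimately show "e \<in> blow_up V c X O blow_up V c Y"
      using ex[of k] by (auto simp: blow_up_def)
  qed
  have A: "blow_up V c (circulant {1..6}) \<subseteq> X O Y"
    if XY: "X \<in> {blow_up V c ?H, (blow_up V c ?H)\<inverse>}" "Y \<in> {blow_up V c ?H, (blow_up V c ?H)\<inverse>}" for X Y
  proof -
    obtain X' Y' where X': "X' \<in> {?H, ?H\<inverse>}" "X = blow_up V c X'"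
      and Y': "Y' \<in> {?H, ?H\<inverse>}" "Y = blow_up V c Y'"
      using XY unfolding blow_up_converse by blast
    have "blow_up V c (circulant {1..6}) \<subseteq> blow_up V c (X' O Y')"
      using circulant_comp[OF X'(1) Y'(1)] by (auto simp: blow_up_def)
    then show ?thesis using comp_blow_up[OF X'(1)] X'(2) Y'(2) by blast
  qed
  have deg: "m \<le> card (blow_up V c K `` {x})" if "x \<in> V" "(c x, i) \<in> K" "i < 7" for K x i
  proof -
    have "{y \<in> V. c y = i} \<subseteq> blow_up V c K `` {x}" "blow_up V c K `` {x} \<subseteq> V"
      using that by (auto simp: blow_up_def)
    then show ?thesis using fibre[OF that(3)] V(1) by (metis card_mono finite_subset)
  qed
  have H_le: "circulant {1, 2, 4} \<subseteq> circulant {1..6}" "circulant {1, 2, 4} \<subseteq> circulant D"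
    using D by (auto simp: circulant_def)
  show ?thesis
  proof
    show "blow_up V c ?H \<subseteq> blow_up V c (circulant D)"
      using H_le(2) by (auto simp: blow_up_def)
    show "blow_up V c (circulant D) \<subseteq> V \<times> V" by (auto simp: blow_up_def)
    fix x
    show "(x, x) \<notin> blow_up V c (circulant D)"
      using D V(3) by (auto simp: blow_up_def circulant_def)
    assume x: "x \<in> V"
    note cx = V(3)[OF x]
    show "m \<le> card (blow_up V c ?H `` {x})"
      using cx by (intro deg[OF x circulant_succ[OF cx, of 1]]) simp_all
    show "m \<le> card ((blow_up V c ?H)\<inverse> `` {x})"
      unfolding blow_up_converse
      \<comment> \<open>Adding 6 goes back by 1, so this colour class is joined to \<open>x\<close>
        by edges of step 1.\<close>
      by (rule deg[OF x, of "(c x + 6) mod 7"]) (simp_all add: circulant_pred[OF cx])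
    \<comment> \<open>Step 3 lies in neither choice of \<open>D\<close>, while its negative 4 lies
      in both. So a node at distance 3 is reached by the full relation and by the converse, but not
      by \<open>R\<close>.\<close>
    have off: "(c x, (c x + 3) mod 7) \<notin> circulant D"
      using diff_mod_7[OF cx, of 3] D by (auto simp: circulant_def)
    obtain y where y: "y \<in> V" "c y = (c x + 3) mod 7" using ex[of "(c x + 3) mod 7"] by auto
    show "\<not> blow_up V c (circulant {1..6}) `` {x} \<subseteq> blow_up V c (circulant D) `` {x}"
      using circulant_succ[OF cx, of 3 "{1..6}"] off x y by (auto simp: blow_up_def)
    have "(c y, c x) \<in> circulant D"
      using circulant_pred[OF cx, of 3 D] y(2) D by auto
    then show "\<not> (blow_up V c (circulant D))\<inverse> `` {x} \<subseteq> blow_up V c (circulant D) `` {x}"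
      using off x y by (auto simp: blow_up_def)
  next
    fix X Y assume XY: "X \<in> {blow_up V c ?H, (blow_up V c ?H)\<inverse>}"
      "Y \<in> {blow_up V c ?H, (blow_up V c ?H)\<inverse>}"
    show "blow_up V c (circulant {1..6}) \<subseteq> X O Y" using A[OF XY] .
    moreover have "blow_up V c ?H \<subseteq> blow_up V c (circulant {1..6})"
      using H_le(1) by (auto simp: blow_up_def)
    ultimately show "covers {blow_up V c ?H, (blow_up V c ?H)\<inverse>} (X O Y)"
      by (intro coversI[of "blow_up V c ?H"]) auto
  qed (use V in auto)
qed

lemma not_definable_disj:
  fixes r :: 'p
  assumes "infinite (UNIV :: 'n set)" and "FDisj \<notin> F"
  shows "\<not> definable_in (Q r FDisj :: ('n, 'p) triples set) F"
proof (rule not_definable_inI)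
  fix T :: "('n, 'p) shape set" assume T: "finite T"
  obtain m where m: "0 < m" and count: "\<And>\<phi>. \<phi> \<in> T \<Longrightarrow> max_count \<phi> \<le> m"
    using max_count_bounded[OF T] by metis
  obtain V where V: "finite V" "card V = 7 * m" "\<And>\<phi>. \<phi> \<in> T \<Longrightarrow> set1_shape \<phi> \<inter> V = {}"
    using fresh_nodes[OF assms(1) T] by metis
  obtain c :: "'n \<Rightarrow> nat" where c_less: "\<And>x. x \<in> V \<Longrightarrow> c x < 7"
    and fibre: "\<And>i. i < 7 \<Longrightarrow> card {x \<in> V. c x = i} = m"
    using equitable_colouring[OF V(1,2)] by metis
  \<comment> \<open>Step 6 reverses step 1, so with it every node of \<open>V\<close> has a two-way
    edge; without it no edge is two-way.\<close>
  let ?R = "blow_up V c (circulant {1, 2, 4, 6})" and ?R' = "blow_up V c (circulant {1, 2, 4})"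
  have mixing: "mixing_relation V ?R' S m (blow_up V c (circulant {1..6}))" if "S \<in> {?R, ?R'}" for S
    using that mixing_blow_up[OF V(1) m c_less fibre] by blast
  note dense = mixing_relation.axioms(1)[OF mixing]
  have "sat (edges r ?R) x \<phi> = sat (edges r ?R') x \<phi>" if "\<phi> \<in> T" "features \<phi> \<subseteq> F" for \<phi> x
  proof (rule sat_dense_cong[OF dense dense, where F = F and w = "\<lambda>\<psi> q. case \<psi> of Eq E p \<Rightarrow> (if q \<and> has_step r E
        then p = r \<and> \<not> off_prop r E \<and> \<not> has_id E else \<not> has_id E \<and> (q \<longrightarrow> p \<noteq> r)) | _ \<Rightarrow> undefined"])
    fix S E p x assume S: "S \<in> {?R, ?R'}"
    show "sat (edges r S) x (Eq E p) = (case Eq E p of Eq E p \<Rightarrow> (if x \<in> V \<and> has_step r E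
        then p = r \<and> \<not> off_prop r E \<and> \<not> has_id E else \<not> has_id E \<and> (x \<in> V \<longrightarrow> p \<noteq> r))
        | _ \<Rightarrow> undefined)"
      by (simp add: mixing_relation.sat_Eq_mixing[OF mixing[OF S]] del: sat.simps)
  next
    show "max_count \<phi> \<le> m" using count[OF that(1)] .
    show "set1_shape \<phi> \<inter> V = {}" using V(3)[OF that(1)] .
  qed (use assms(2) that(2) in simp_all)
  moreover have fin: "finite ?R" "finite ?R'"
    using V(1) by (simp_all add: finite_blow_up)
  have ex: "\<exists>x\<in>V. c x = i" if "i < 7" for i
    using fibre[OF that] m by (metis (mono_tags, lifting) card.empty empty_Collect_eq less_irrefl)
  have "edges r ?R \<in> Q r FDisj"
  proof -
    have "\<exists>y. (x, y) \<in> ?R \<and> (y, x) \<in> ?R" if "x \<in> V" for x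
    proof -
      note cx = c_less[OF that]
      obtain y where y: "y \<in> V" "c y = (c x + 1) mod 7" using ex[of "(c x + 1) mod 7"] by auto
      have "(c y, c x) \<in> circulant {1, 2, 4, 6}"
        using circulant_pred[OF cx, of 1 "{1, 2, 4, 6}"] y(2) by simp
      moreover have "(c x, c y) \<in> circulant {1, 2, 4, 6}"
        using circulant_succ[OF cx, of 1 "{1, 2, 4, 6}"] y(2) by simp
      ultimately show ?thesis using that y(1) by (auto simp: blow_up_def)
    qed
    then have "\<exists>y. (x, y) \<in> ?R \<and> (y, x) \<in> ?R" if "(x, z) \<in> ?R" for x z
      using that by (simp add: blow_up_def)
    then show ?thesis using fin by (auto simp: finite_edges)
  qed
  moreover have "edges r ?R' \<notin> Q r FDisj"
  proof -
    obtain x where x: "x \<in> V" "c x = 0" using ex[of 0] by auto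
    obtain y where y: "y \<in> V" "c y = 1" using ex[of 1] by auto
    have "(x, y) \<in> ?R'" using x y by (auto simp: blow_up_def circulant_def)
    moreover have "\<not> (\<exists>z. (x, z) \<in> ?R' \<and> (z, x) \<in> ?R')"
      using circulant_antisym by (auto simp: blow_up_def)
    ultimately show ?thesis by auto
  qed
  ultimately show "\<exists>G G'. finite G \<and> finite G' \<and> G \<in> Q r FDisj \<and> G' \<notin> Q r FDisj \<and>
      (\<forall>\<phi>\<in>T. features \<phi> \<subseteq> F \<longrightarrow> (\<forall>x. sat G x \<phi> = sat G' x \<phi>))"
    using fin by (intro exI[of _ "edges r ?R"] exI[of _ "edges r ?R'"]) (simp add: finite_edges)
qed

theorem theorem3p1:
  fixes r :: 'p and X :: feature and F :: "feature set"
  assumes "infinite (UNIV :: 'n set)" and "infinite (UNIV :: 'p set)"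
    and "X \<notin> F"
  shows "\<not> definable_in (Q r X :: ('n, 'p) triples set) F"
proof (cases X)
  case FEq
  then show ?thesis using assms(3) not_definable_eq[OF assms(1)] by (simp only:)
next
  case FDisj
  then show ?thesis using assms(3) not_definable_disj[OF assms(1)] by (simp only:)
next
  case FClosed
  then show ?thesis using assms(3) not_definable_closed[OF assms(2)] by (simp only:)
qed

end
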